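(* Let $A$ be a unital algebra over a field $F$. Suppose $A$ contains an element $v$ such that $1\in A_v=\bigcap_{k\in\mathbb N}[v,A]_k$. Then $A_v\subseteq f(A;v)$ for every nonzero admissible partially commutative polynomial $f$ (that is, for every $n\in\mathbb N$ and every nonzero admissible $f\in F\langle X_1,\dots,X_n\rangle\amalg F[U,V]$).
   Context: $\mathbb N=\{1,2,\dots\}$, $\mathbb N_0=\mathbb N\cup\{0\}$, $[x,y]=xy-yx$, and $[x,y]_k=[x,[x,\dots,[x,y]\dots]]$ with $x$ occurring $k$ times ($[x,y]_0=y$). For $v\in A$, $[v,A]_k=\{[v,a]_k\mid a\in A\}$. For a field $F$ and $n\in\mathbb N$, $F\langle X_1,\dots,X_n\rangle\amalg F[U,V]$ denotes the coproduct (of unital associative $F$-algebras) of the free algebra $F\langle X_1,\dots,X_n\rangle$ and the algebra $F[U,V]$ of polynomials in two commuting variables; its elements are called partially commutative polynomials. For a unital $F$-algebra $A$ and a fixed $v\in A$, let $F[v]$ be the unital subalgebra generated by $v$. For $x_1,\dots,x_n\in A$ and $u\in F[v]$, let $\mathrm{Ev}_{x_1,\dots,x_n;u}:F\langle X_1,\dots,X_n\rangle\amalg F[U,V]\to A$ be the algebra homomorphism with $X_i\mapsto x_i$, $U\mapsto u$, $V\mapsto v$. The image of $f$ is $f(A;v)=\{\mathrm{Ev}_{x_1,\dots,x_n;u}(f)\mid x_1,\dots,x_n\in A,\ u\in F[v]\}$. For $r\in\mathbb N_0$ let $\mathcal B_r=\{b=(b_1,\dots,b_n)\in\mathbb N_0^n\mid\sum_i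 b_i=r\}$. For $b\in\mathcal B_r$ and $i,j\in\{1,\dots,n\}$ put $X_j^b=[V,X_j]_{b_j}$, and $X_j^{b,i}=[U,X_j^b]$ if $j=i$, $X_j^{b,i}=X_j^b$ if $j\neq i$. Extend to words by $(X_{j_1}\cdots X_{j_k})^b=X_{j_1}^b\cdots X_{j_k}^b$ and $(X_{j_1}\cdots X_{j_k})^{b,i}=X_{j_1}^{b,i}\cdots X_{j_k}^{b,i}$. A partially commutative polynomial $f$ is admissible if there is an $r\in\mathbb N_0$ such that either $f=\sum_{\sigma\in S_n}\sum_{b\in\mathcal B_r}\lambda_\sigma^b\,(X_{\sigma(1)}\cdots X_{\sigma(n)})^b$ for some $\lambda_\sigma^b\in F$ (type one), or $f=\sum_{\sigma\in S_n}\sum_{b\in\mathcal B_r}\sum_{i=1}^n\lambda_{\sigma,i}^b\,(X_{\sigma(1)}\cdots X_{\sigma(n)})^{b,\sigma(i)}$ for some $\lambda_{\sigma,i}^b\in F$ (type two). *)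

theory Defs
  imports
    Complex_Main
    "HOL-Library.Poly_Mapping"
    "HOL-Library.FuncSet"
    "HOL-Combinatorics.Permutations"
begin

section \<open>Unital algebras over a field\<close>

text \<open>The sort \<open>{ring, monoid_mult}\<close> is used in place of \<open>ring_1\<close> because the latter
  excludes the zero algebra.\<close>

locale unital_algebra = vector_space scale
  for scale :: "'f::field \<Rightarrow> 'a::{ring,monoid_mult} \<Rightarrow> 'a" (infixr \<open>*s\<close> 75) +
  assumes scale_mult_left: "(c *s x) * y = c *s (x * y)"
    and scale_mult_right: "x * (c *s y) = c *s (x * y)"
begin

definition subalgebra :: "'a set \<Rightarrow> bool"
  where "subalgebra S \<longleftrightarrow> subspace S \<and> 1 \<in> S \<and> (\<forall>x\<in>S. \<forall>y\<in>S. x * y \<in> S)"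

definition generated_subalgebra :: "'a set \<Rightarrow> 'a set"
  where "generated_subalgebra B = subalgebra hull B"

end

definition algebra_hom ::
    "('f::field \<Rightarrow> 'a::{ring,monoid_mult} \<Rightarrow> 'a) \<Rightarrow>
     ('f \<Rightarrow> 'b::{ring,monoid_mult} \<Rightarrow> 'b) \<Rightarrow> ('a \<Rightarrow> 'b) \<Rightarrow> bool"
  where "algebra_hom s1 s2 h \<longleftrightarrow>
    module_hom s1 s2 h \<and> h 1 = 1 \<and> (\<forall>x y. h (x * y) = h x * h y)"

definition commutator :: "'a::ring \<Rightarrow> 'a \<Rightarrow> 'a"
  where "commutator x y = x * y - y * x"

definition iter_commutator :: "'a::ring \<Rightarrow> nat \<Rightarrow> 'a \<Rightarrow> 'a"
  where "iter_commutator x k y = (commutator x ^^ k) y"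

definition commutator_core :: "'a::ring \<Rightarrow> 'a set"
  where "commutator_core v = (\<Inter>k\<in>{1..}. range (iter_commutator v k))"


section \<open>Partially commutative polynomials\<close>

text \<open>The coproduct of \<open>F\<langle>X\<^sub>1, X\<^sub>2, \<dots>\<rangle>\<close> and \<open>F[U, V]\<close> is realised as the monoid algebra over \<open>F\<close>
  of the monoid of words in the letters \<open>X\<^sub>j\<close>, \<open>U\<close>, \<open>V\<close> modulo the congruence generated
  by \<open>UV = VU\<close>.\<close>

datatype pc_letter = LX nat | LU | LV

inductive pc_swap :: "pc_letter list \<Rightarrow> pc_letter list \<Rightarrow> bool"
  where "pc_swap (s @ [LU, LV] @ t) (s @ [LV, LU] @ t)"

quotient_type pc_monom = "pc_letter list" / "equivclp pc_swap"
  by simp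

lemma pc_swap_context: "pc_swap x y \<Longrightarrow> pc_swap (a @ x @ b) (a @ y @ b)"
proof (induction rule: pc_swap.induct)
  case (1 s t)
  show ?case using pc_swap.intros[of "a @ s" "t @ b"] by simp
qed

lemma equivclp_pc_swap_context:
  "equivclp pc_swap x y \<Longrightarrow> equivclp pc_swap (a @ x @ b) (a @ y @ b)"
proof (induction rule: equivclp_induct)
  case (step y z)
  then have "equivclp pc_swap (a @ y @ b) (a @ z @ b)"
    by (auto simp: equivclp_def symclp_def intro!: r_into_rtranclp dest: pc_swap_context)
  with step.IH show ?case by (rule equivclp_trans)
qed simp

text \<open>The monoid of monomials is written additively, since \<^theory>\<open>HOL-Library.Poly_Mapping\<close>
  uses additive monoids of exponents; \<open>+\<close> is the (non-commutative) concatenation of words.\<close>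

instantiation pc_monom :: monoid_add
begin

lift_definition zero_pc_monom :: pc_monom is "[]" .

lift_definition plus_pc_monom :: "pc_monom \<Rightarrow> pc_monom \<Rightarrow> pc_monom" is append
proof -
  fix a b c d
  assume ab: "equivclp pc_swap a b" and cd: "equivclp pc_swap c d"
  have "equivclp pc_swap (a @ c) (b @ c)"
    using equivclp_pc_swap_context[OF ab, of "[]" c] by simp
  moreover have "equivclp pc_swap (b @ c) (b @ d)"
    using equivclp_pc_swap_context[OF cd, of b "[]"] by simp
  ultimately show "equivclp pc_swap (a @ c) (b @ d)"
    by (rule equivclp_trans)
qed

instance
  by (standard; transfer) simp_all

end

lift_definition letters :: "pc_monom \<Rightarrow> pc_letter set" is set
proof -
  fix a b
  assume "equivclp pc_swap a b"
  moreover have "set x = set y" if "pc_swap x y" for x y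
    using that by (induction rule: pc_swap.induct) auto
  ultimately show "set a = set b"
    by (induction rule: equivclp_induct) blast+
qed

type_synonym 'f pc_poly = "pc_monom \<Rightarrow>\<^sub>0 'f"

definition pc_scale :: "'f::field \<Rightarrow> 'f pc_poly \<Rightarrow> 'f pc_poly"
  where "pc_scale c f = Poly_Mapping.map ((*) c) f"

definition pc_gen :: "pc_letter \<Rightarrow> 'f::field pc_poly"
  where "pc_gen l = Poly_Mapping.single (abs_pc_monom [l]) 1"

abbreviation pcX :: "nat \<Rightarrow> 'f::field pc_poly"
  where "pcX j \<equiv> pc_gen (LX j)"

abbreviation pcU :: "'f::field pc_poly"
  where "pcU \<equiv> pc_gen LU"

abbreviation pcV :: "'f::field pc_poly"
  where "pcV \<equiv> pc_gen LV"

text \<open>The coproduct of \<open>F\<langle>X\<^sub>1, \<dots>, X\<^sub>n\<rangle>\<close> and \<open>F[U, V]\<close>, as a subalgebra of the one with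
  countably many \<open>X\<^sub>j\<close>.\<close>

definition pc_polys :: "nat \<Rightarrow> 'f::field pc_poly set"
  where "pc_polys n =
    {f. \<forall>m \<in> Poly_Mapping.keys f. letters m \<subseteq> LX ` {1..n} \<union> {LU, LV}}"


subsection \<open>Evaluation\<close>

definition is_pc_eval ::
    "('f::field \<Rightarrow> 'a::{ring,monoid_mult} \<Rightarrow> 'a) \<Rightarrow> (nat \<Rightarrow> 'a) \<Rightarrow> 'a \<Rightarrow> 'a \<Rightarrow>
     ('f pc_poly \<Rightarrow> 'a) \<Rightarrow> bool"
  where "is_pc_eval scale x u v h \<longleftrightarrow>
    algebra_hom pc_scale scale h \<and> (\<forall>j. h (pcX j) = x j) \<and> h pcU = u \<and> h pcV = v"

text \<open>Well defined when \<open>u\<close> and \<open>v\<close> commute, in particular for \<open>u \<in> F[v]\<close>; see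
  \<open>pc_eval_unique\<close> below. On \<open>pc_polys n\<close> only the values \<open>x 1, \<dots>, x n\<close> matter; see
  \<open>pc_eval_cong\<close>.\<close>

definition pc_eval ::
    "('f::field \<Rightarrow> 'a::{ring,monoid_mult} \<Rightarrow> 'a) \<Rightarrow> (nat \<Rightarrow> 'a) \<Rightarrow> 'a \<Rightarrow> 'a \<Rightarrow> 'f pc_poly \<Rightarrow> 'a"
  where "pc_eval scale x u v = (THE h. is_pc_eval scale x u v h)"

definition pc_image ::
    "('f::field \<Rightarrow> 'a::{ring,monoid_mult} \<Rightarrow> 'a) \<Rightarrow> 'f pc_poly \<Rightarrow> 'a \<Rightarrow> 'a set"
  where "pc_image scale f v =
    {pc_eval scale x u v f | x u. u \<in> unital_algebra.generated_subalgebra scale {v}}"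


subsection \<open>Admissible polynomials\<close>

text \<open>The set \<open>\<B>\<^sub>r\<close>; tuples \<open>(b\<^sub>1, \<dots>, b\<^sub>n)\<close> are extensional functions on \<open>{1..n}\<close>, so that this
  index set is finite (\<open>finite_weak_compositions\<close>).\<close>

definition weak_compositions :: "nat \<Rightarrow> nat \<Rightarrow> (nat \<Rightarrow> nat) set"
  where "weak_compositions n r = {b \<in> {1..n} \<rightarrow>\<^sub>E UNIV. (\<Sum>i=1..n. b i) = r}"

definition Xb :: "(nat \<Rightarrow> nat) \<Rightarrow> nat \<Rightarrow> 'f::field pc_poly"
  where "Xb b j = iter_commutator pcV (b j) (pcX j)"

definition Xbi :: "(nat \<Rightarrow> nat) \<Rightarrow> nat \<Rightarrow> nat \<Rightarrow> 'f::field pc_poly"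
  where "Xbi b i j = (if j = i then commutator pcU (Xb b j) else Xb b j)"

text \<open>A list \<open>js = [j\<^sub>1, \<dots>, j\<^sub>k]\<close> stands for the word \<open>X\<^bsub>j\<^sub>1\<^esub> \<cdots> X\<^bsub>j\<^sub>k\<^esub>\<close>.\<close>

definition word_b :: "(nat \<Rightarrow> nat) \<Rightarrow> nat list \<Rightarrow> 'f::field pc_poly"
  where "word_b b js = prod_list (map (Xb b) js)"

definition word_bi :: "(nat \<Rightarrow> nat) \<Rightarrow> nat \<Rightarrow> nat list \<Rightarrow> 'f::field pc_poly"
  where "word_bi b i js = prod_list (map (Xbi b i) js)"

definition type_one :: "nat \<Rightarrow> nat \<Rightarrow> 'f::field pc_poly \<Rightarrow> bool"
  where "type_one n r f \<longleftrightarrow>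
    (\<exists>coef :: (nat \<Rightarrow> nat) \<Rightarrow> (nat \<Rightarrow> nat) \<Rightarrow> 'f.
      f = (\<Sum>\<sigma> | \<sigma> permutes {1..n}. \<Sum>b\<in>weak_compositions n r.
             pc_scale (coef \<sigma> b) (word_b b (map \<sigma> [1..<n+1]))))"

definition type_two :: "nat \<Rightarrow> nat \<Rightarrow> 'f::field pc_poly \<Rightarrow> bool"
  where "type_two n r f \<longleftrightarrow>
    (\<exists>coef :: (nat \<Rightarrow> nat) \<Rightarrow> nat \<Rightarrow> (nat \<Rightarrow> nat) \<Rightarrow> 'f.
      f = (\<Sum>\<sigma> | \<sigma> permutes {1..n}. \<Sum>b\<in>weak_compositions n r. \<Sum>i=1..n.
             pc_scale (coef \<sigma> i b) (word_bi b (\<sigma> i) (map \<sigma> [1..<n+1]))))"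

definition admissible :: "nat \<Rightarrow> 'f::field pc_poly \<Rightarrow> bool"
  where "admissible n f \<longleftrightarrow> (\<exists>r. type_one n r f \<or> type_two n r f)"

lemma finite_weak_compositions: "finite (weak_compositions n r)"
proof (rule finite_subset)
  show "weak_compositions n r \<subseteq> {1..n} \<rightarrow>\<^sub>E {..r}"
  proof
    fix b assume "b \<in> weak_compositions n r"
    then have b: "b \<in> {1..n} \<rightarrow>\<^sub>E UNIV" and s: "(\<Sum>i=1..n. b i) = r"
      by (auto simp: weak_compositions_def)
    have "b i \<le> r" if "i \<in> {1..n}" for i
      using member_le_sum[OF that, of b] s by simp
    with b show "b \<in> {1..n} \<rightarrow>\<^sub>E {..r}" by (auto simp: PiE_iff)
  qed
  show "finite ({1..n} \<rightarrow>\<^sub>E {..r})" by (intro finite_PiE) auto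
qed


subsection \<open>Universal property of the coproduct\<close>

lemma pc_scale_conv_mult: "pc_scale c f = Poly_Mapping.single 0 c * f"
  by (simp add: pc_scale_def mult_map_scale_conv_mult)

lemma lookup_pc_scale: "Poly_Mapping.lookup (pc_scale c f) m = c * Poly_Mapping.lookup f m"
  unfolding pc_scale_def by (simp add: Poly_Mapping.map.rep_eq when_def)

lemma pc_scale_single: "pc_scale c (Poly_Mapping.single m d) = Poly_Mapping.single m (c * d)"
  by (simp add: pc_scale_conv_mult mult_single)

lemma single_0_commute: "Poly_Mapping.single 0 c * f = f * Poly_Mapping.single 0 c"
  for f :: "'f::field pc_poly"
proof (induction f rule: update_induct)
  case const
  then show ?case by simp
next
  case (update f a b)
  have "Poly_Mapping.update a b f = f + Poly_Mapping.single a b"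
    using update by (intro poly_mapping_eqI)
      (auto simp: lookup_update lookup_add lookup_single when_def in_keys_iff)
  then show ?case
    using update by (simp add: algebra_simps mult_single)
qed

lemma unital_algebra_pc_scale: "unital_algebra (pc_scale :: 'f::field \<Rightarrow> 'f pc_poly \<Rightarrow> 'f pc_poly)"
proof
  fix a b :: 'f and x y :: "'f pc_poly"
  show "pc_scale a (x + y) = pc_scale a x + pc_scale a y"
    by (intro poly_mapping_eqI) (simp add: lookup_pc_scale lookup_add algebra_simps)
  show "pc_scale (a + b) x = pc_scale a x + pc_scale b x"
    by (intro poly_mapping_eqI) (simp add: lookup_pc_scale lookup_add algebra_simps)
  show "pc_scale a (pc_scale b x) = pc_scale (a * b) x" "pc_scale 1 x = x"
    by (intro poly_mapping_eqI, simp add: lookup_pc_scale)+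
  show "pc_scale a x * y = pc_scale a (x * y)"
    by (simp add: pc_scale_conv_mult mult.assoc)
  show "x * pc_scale a y = pc_scale a (x * y)"
  proof -
    have "x * (Poly_Mapping.single 0 a * y) = (x * Poly_Mapping.single 0 a) * y"
      by (simp only: mult.assoc)
    also have "\<dots> = Poly_Mapping.single 0 a * (x * y)"
      by (simp only: single_0_commute[symmetric] mult.assoc)
    finally show ?thesis by (simp only: pc_scale_conv_mult)
  qed
qed

lemma pcU_pcV_commute: "pcU * pcV = pcV * (pcU :: 'f::field pc_poly)"
proof -
  have "equivclp pc_swap [LU, LV] [LV, LU]"
    using pc_swap.intros[of "[]" "[]"] by auto
  then have "abs_pc_monom [LU] + abs_pc_monom [LV] = abs_pc_monom [LV] + abs_pc_monom [LU]"
    by (simp add: plus_pc_monom.abs_eq pc_monom.abs_eq_iff)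
  then show ?thesis by (simp add: pc_gen_def mult_single)
qed

fun letter_val :: "(nat \<Rightarrow> 'a) \<Rightarrow> 'a \<Rightarrow> 'a \<Rightarrow> pc_letter \<Rightarrow> 'a" where
  "letter_val x u v (LX j) = x j"
| "letter_val x u v LU = u"
| "letter_val x u v LV = v"

lemma prod_list_letter_val_cong:
  fixes u v :: "'a::monoid_mult"
  assumes "equivclp pc_swap a b" and "u * v = v * u"
  shows "prod_list (map (letter_val x u v) a) = prod_list (map (letter_val x u v) b)"
proof -
  have swap: "prod_list (map (letter_val x u v) c) = prod_list (map (letter_val x u v) d)"
    if "pc_swap c d" for c d
    using that
  proof cases
    case (1 s t)
    then show ?thesis using assms(2) by (simp flip: mult.assoc)
  qed
  show ?thesis
    using assms(1) by (induction rule: equivclp_induct) (auto dest: swap)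
qed

definition monom_val :: "(nat \<Rightarrow> 'a::monoid_mult) \<Rightarrow> 'a \<Rightarrow> 'a \<Rightarrow> pc_monom \<Rightarrow> 'a"
  where "monom_val x u v m = prod_list (map (letter_val x u v) (rep_pc_monom m))"

lemma monom_val_abs:
  assumes "u * v = v * u"
  shows "monom_val x u v (abs_pc_monom w) = prod_list (map (letter_val x u v) w)"
  unfolding monom_val_def
  by (rule prod_list_letter_val_cong[OF _ assms])
    (metis Quotient3_abs_rep Quotient3_pc_monom pc_monom.abs_eq_iff)

lemma monom_val_plus:
  assumes "u * v = v * u"
  shows "monom_val x u v (m + m') = monom_val x u v m * monom_val x u v m'"
proof -
  obtain w w' where [simp]: "m = abs_pc_monom w" "m' = abs_pc_monom w'"
    by (metis Quotient3_abs_rep Quotient3_pc_monom)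
  show ?thesis by (simp add: plus_pc_monom.abs_eq monom_val_abs[OF assms])
qed

lemma monom_val_0: "u * v = v * u \<Longrightarrow> monom_val x u v 0 = 1"
  by (simp add: zero_pc_monom_def monom_val_abs)

context unital_algebra
begin

definition explicit_eval :: "(nat \<Rightarrow> 'a) \<Rightarrow> 'a \<Rightarrow> 'a \<Rightarrow> 'f pc_poly \<Rightarrow> 'a"
  where "explicit_eval x u v f =
    (\<Sum>m\<in>Poly_Mapping.keys f. Poly_Mapping.lookup f m *s monom_val x u v m)"

lemma explicit_eval_superset:
  assumes "finite S" "Poly_Mapping.keys f \<subseteq> S"
  shows "explicit_eval x u v f = (\<Sum>m\<in>S. Poly_Mapping.lookup f m *s monom_val x u v m)"
  unfolding explicit_eval_def
  using assms by (intro sum.mono_neutral_left) (auto simp: in_keys_iff)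

lemma explicit_eval_add:
  "explicit_eval x u v (f + g) = explicit_eval x u v f + explicit_eval x u v g"
proof -
  let ?S = "Poly_Mapping.keys f \<union> Poly_Mapping.keys g"
  have "Poly_Mapping.keys (f + g) \<subseteq> ?S" by (rule keys_add)
  then show ?thesis
    by (simp add: explicit_eval_superset[of ?S] lookup_add scale_left_distrib sum.distrib)
qed

lemma explicit_eval_scale: "explicit_eval x u v (pc_scale c f) = c *s explicit_eval x u v f"
proof -
  have "Poly_Mapping.keys (pc_scale c f) \<subseteq> Poly_Mapping.keys f"
    by (auto simp: in_keys_iff lookup_pc_scale)
  then show ?thesis
    by (simp add: explicit_eval_superset[of "Poly_Mapping.keys f"] lookup_pc_scale scale_sum_right)
qed

lemma explicit_eval_single:
  "explicit_eval x u v (Poly_Mapping.single m c) = c *s monom_val x u v m"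
  by (simp add: explicit_eval_superset[of "{m}"])

lemma explicit_eval_mult:
  assumes "u * v = v * u"
  shows "explicit_eval x u v (f * g) = explicit_eval x u v f * explicit_eval x u v g"
proof (induction f rule: update_induct)
  case const
  then show ?case by (simp add: explicit_eval_def)
next
  case (update f a b)
  have f: "Poly_Mapping.update a b f = f + Poly_Mapping.single a b"
    using update by (intro poly_mapping_eqI)
      (auto simp: lookup_update lookup_add lookup_single when_def in_keys_iff)
  have "explicit_eval x u v (Poly_Mapping.single a b * g) =
    explicit_eval x u v (Poly_Mapping.single a b) * explicit_eval x u v g"
  proof (induction g rule: update_induct)
    case const
    then show ?case by (simp add: explicit_eval_def)
  next
    case (update g c d)
    have g: "Poly_Mapping.update c d g = g + Poly_Mapping.single c d"
      using update by (intro poly_mapping_eqI)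
        (auto simp: lookup_update lookup_add lookup_single when_def in_keys_iff)
    have "explicit_eval x u v (Poly_Mapping.single a b * Poly_Mapping.single c d) =
      explicit_eval x u v (Poly_Mapping.single a b) * explicit_eval x u v (Poly_Mapping.single c d)"
      by (simp add: mult_single explicit_eval_single monom_val_plus[OF assms]
          scale_mult_left scale_mult_right)
    with update show ?case by (simp add: g distrib_left explicit_eval_add)
  qed
  with update show ?case by (simp add: f distrib_right explicit_eval_add)
qed

lemma is_pc_eval_explicit_eval:
  assumes "u * v = v * u"
  shows "is_pc_eval scale x u v (explicit_eval x u v)"
proof -
  interpret P: unital_algebra "pc_scale :: 'f \<Rightarrow> 'f pc_poly \<Rightarrow> 'f pc_poly"
    by (rule unital_algebra_pc_scale)
  have one: "explicit_eval x u v 1 = 1"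
    using explicit_eval_single[of x u v 0 1] monom_val_0[OF assms] by simp
  have "module_hom pc_scale scale (explicit_eval x u v)"
    by unfold_locales (simp_all add: explicit_eval_add explicit_eval_scale)
  with one show ?thesis
    by (simp add: is_pc_eval_def algebra_hom_def explicit_eval_mult[OF assms] pc_gen_def
        explicit_eval_single monom_val_abs[OF assms])
qed

lemma is_pc_eval_single:
  assumes "is_pc_eval scale x u v h"
  shows "h (Poly_Mapping.single (abs_pc_monom w) c) = c *s prod_list (map (letter_val x u v) w)"
proof -
  interpret module_hom pc_scale scale h
    using assms by (simp add: is_pc_eval_def algebra_hom_def)
  have gen: "h (pc_gen l) = letter_val x u v l" for l
    using assms by (cases l) (auto simp: is_pc_eval_def)
  have "h (Poly_Mapping.single (abs_pc_monom w) 1) = prod_list (map (letter_val x u v) w)"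
  proof (induction w)
    case Nil
    then show ?case
      using assms by (simp add: is_pc_eval_def algebra_hom_def flip: zero_pc_monom.abs_eq)
  next
    case (Cons l w)
    have "Poly_Mapping.single (abs_pc_monom (l # w)) 1 =
      pc_gen l * (Poly_Mapping.single (abs_pc_monom w) 1 :: 'f pc_poly)"
      by (simp add: pc_gen_def mult_single plus_pc_monom.abs_eq)
    then show ?case
      using assms Cons gen by (simp add: is_pc_eval_def algebra_hom_def)
  qed
  then show ?thesis
    using scale[of c "Poly_Mapping.single (abs_pc_monom w) 1"] by (simp add: pc_scale_single)
qed

lemma is_pc_eval_eq_explicit_eval:
  assumes "u * v = v * u" and "is_pc_eval scale x u v h"
  shows "h f = explicit_eval x u v f"
proof (induction f rule: update_induct)
  case const
  interpret module_hom pc_scale scale h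
    using assms by (simp add: is_pc_eval_def algebra_hom_def)
  show ?case using zero by (simp add: explicit_eval_def)
next
  case (update f a b)
  interpret module_hom pc_scale scale h
    using assms by (simp add: is_pc_eval_def algebra_hom_def)
  have f: "Poly_Mapping.update a b f = f + Poly_Mapping.single a b"
    using update by (intro poly_mapping_eqI)
      (auto simp: lookup_update lookup_add lookup_single when_def in_keys_iff)
  obtain w where w: "a = abs_pc_monom w"
    by (metis Quotient3_abs_rep Quotient3_pc_monom)
  show ?case
    using update is_pc_eval_single[OF assms(2), of w b]
    by (simp add: f[unfolded w] add explicit_eval_add explicit_eval_single w monom_val_abs[OF assms(1)])
qed

lemma pc_eval_unique:
  assumes "u * v = v * u"
  shows "\<exists>!h. is_pc_eval scale x u v h"
  using is_pc_eval_explicit_eval[OF assms] is_pc_eval_eq_explicit_eval[OF assms]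
  by (metis ext)

lemma pc_eval_eq_explicit_eval:
  assumes "u * v = v * u"
  shows "pc_eval scale x u v = explicit_eval x u v"
  unfolding pc_eval_def
  using is_pc_eval_explicit_eval[OF assms] pc_eval_unique[OF assms] by (rule the1_equality[rotated])

lemma pc_eval_cong:
  assumes "u * v = v * u" and "f \<in> pc_polys n" and "\<And>j. j \<in> {1..n} \<Longrightarrow> x j = y j"
  shows "pc_eval scale x u v f = pc_eval scale y u v f"
proof -
  have "monom_val x u v m = monom_val y u v m" if "m \<in> Poly_Mapping.keys f" for m
  proof -
    obtain w where w: "m = abs_pc_monom w"
      by (metis Quotient3_abs_rep Quotient3_pc_monom)
    have "letters m = set w" by (simp add: w letters.abs_eq)
    with assms(2) that have "set w \<subseteq> LX ` {1..n} \<union> {LU, LV}"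
      unfolding pc_polys_def by blast
    then have "map (letter_val x u v) w = map (letter_val y u v) w"
      using assms(3) by (intro map_cong) auto
    then show ?thesis by (simp only: w monom_val_abs[OF assms(1)])
  qed
  then show ?thesis
    by (simp add: pc_eval_eq_explicit_eval[OF assms(1)] explicit_eval_def)
qed

lemma generated_subalgebra_commute:
  assumes "u \<in> generated_subalgebra {v}"
  shows "u * v = v * u"
proof -
  have "subalgebra {a. a * v = v * a}"
    by (auto simp: subalgebra_def subspace_def algebra_simps scale_mult_left scale_mult_right)
      (metis mult.assoc)
  then have "generated_subalgebra {v} \<subseteq> {a. a * v = v * a}"
    unfolding generated_subalgebra_def by (intro hull_minimal) auto
  with assms show ?thesis by auto
qed

end

end

(*
  Write D = [v, _]. A nonzero combination of words in derivatives of x_1, ..., x_n is reduced to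
  one with fewer variables: if B is the least exponent of x_j that occurs and D^B z = 1, then
  x_j = z u with u in F[v] removes all words with a higher exponent of x_j and puts u in the place
  of x_j elsewhere. Such an insertion of u (into which a polynomial of type two expands as well)
  is turned back into a combination of words of derivatives by u = v^m: moving v^m to the left
  differentiates the prefixes that it passes, and for the least m for which the m-th derivatives
  of prefixes do not cancel, all terms with a remaining factor v vanish.
*)

theory Submission
  imports Defs
begin

section \<open>Words in derivatives of the variables\<close>

text \<open>The pair \<open>(j, b)\<close> stands for \<open>[V, X\<^sub>j]\<^sub>b\<close>.\<close>

type_synonym dword = "(nat \<times> nat) list"

text \<open>These are the multilinear words: each variable of \<open>S\<close> occurs once and
  \<open>r\<close> counts all derivatives. Lists make it possible to cut a word at a
  position.\<close>

definition dwords :: "nat set \<Rightarrow> nat \<Rightarrow> dword set"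
  where "dwords S r =
    {l. distinct (map fst l) \<and> set (map fst l) = S \<and> sum_list (map snd l) = r}"

definition dword_val :: "'a::{ring,monoid_mult} \<Rightarrow> (nat \<Rightarrow> 'a) \<Rightarrow> dword \<Rightarrow> 'a"
  where "dword_val v x l = prod_list (map (\<lambda>(j, b). iter_commutator v b (x j)) l)"

text \<open>Here \<open>j\<close> is a position in the word, not the name of a variable; the same
  holds for \<open>dec\<close>.\<close>

definition inc :: "nat \<Rightarrow> dword \<Rightarrow> dword"
  where "inc j l = l[j := apsnd Suc (l ! j)]"

definition dec :: "nat \<Rightarrow> dword \<Rightarrow> dword"
  where "dec j l = l[j := apsnd (\<lambda>b. b - 1) (l ! j)]"

lemma length_dwords: "l \<in> dwords S r \<Longrightarrow> length l = card S"
  unfolding dwords_def using distinct_card by fastforce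

lemma snd_nth_le_dwords: "l \<in> dwords S r \<Longrightarrow> j < length l \<Longrightarrow> snd (l ! j) \<le> r"
  unfolding dwords_def using elem_le_sum_list[of j "map snd l"] by auto

lemma finite_dwords: "finite S \<Longrightarrow> finite (dwords S r)"
proof (rule finite_subset)
  show "dwords S r \<subseteq> {l. set l \<subseteq> S \<times> {..r} \<and> length l = card S}"
  proof
    fix l assume l: "l \<in> dwords S r"
    have "fst p \<in> S \<and> snd p \<le> r" if "p \<in> set l" for p
    proof
      show "fst p \<in> S" using l that by (auto simp: dwords_def)
      show "snd p \<le> r" using snd_nth_le_dwords[OF l] that by (auto simp: in_set_conv_nth)
    qed
    then show "l \<in> {l. set l \<subseteq> S \<times> {..r} \<and> length l = card S}"
      using length_dwords[OF l] by auto
  qed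
qed (simp add: finite_lists_length_eq)

lemma length_inc [simp]: "length (inc j l) = length l"
  and length_dec [simp]: "length (dec j l) = length l"
  by (simp_all add: inc_def dec_def)

lemma snd_nth_inc: "j < length l \<Longrightarrow> snd (inc j l ! i) = (if i = j then Suc (snd (l ! j)) else snd (l ! i))"
  by (auto simp: inc_def nth_list_update)

lemma snd_nth_dec: "j < length l \<Longrightarrow> snd (dec j l ! i) = (if i = j then snd (l ! j) - 1 else snd (l ! i))"
  by (auto simp: dec_def nth_list_update)

lemma dec_inc [simp]: "j < length l \<Longrightarrow> dec j (inc j l) = l"
  by (simp add: inc_def dec_def apsnd_def map_prod_def split_beta)

lemma inc_dec: "j < length l \<Longrightarrow> snd (l ! j) \<noteq> 0 \<Longrightarrow> inc j (dec j l) = l"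
  by (simp add: inc_def dec_def apsnd_def map_prod_def split_beta)

lemma map_fst_inc [simp]: "map fst (inc j l) = map fst l"
  and map_fst_dec [simp]: "map fst (dec j l) = map fst l"
  by (simp_all add: inc_def dec_def map_update)
    (metis list_update_id map_update)+

lemma sum_list_inc: "j < length l \<Longrightarrow> sum_list (map snd (inc j l)) = Suc (sum_list (map snd l))"
proof (induction l arbitrary: j)
  case (Cons p l)
  then show ?case by (cases j) (simp_all add: inc_def)
qed simp

lemma inc_in_dwords:
  assumes "l \<in> dwords S r" "j < card S"
  shows "inc j l \<in> dwords S (Suc r)"
  using assms length_dwords[OF assms(1)] sum_list_inc[of j l]
  unfolding dwords_def mem_Collect_eq map_fst_inc by metis

lemma dec_in_dwords:
  assumes "l \<in> dwords S (Suc r)" "j < card S" "snd (l ! j) \<noteq> 0"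
  shows "dec j l \<in> dwords S r"
proof -
  have j: "j < length l" using assms(2) length_dwords[OF assms(1)] by simp
  have "Suc (sum_list (map snd (dec j l))) = sum_list (map snd l)"
    using sum_list_inc[of j "dec j l"] j by (simp only: inc_dec[OF j assms(3)] length_dec)
  then show ?thesis
    using assms(1) unfolding dwords_def mem_Collect_eq map_fst_dec by (metis Suc_inject)
qed

section \<open>The derivation \<open>commutator v\<close> and its iterates\<close>

lemma iter_commutator_0 [simp]: "iter_commutator v 0 y = y"
  and iter_commutator_Suc: "iter_commutator v (Suc k) y = commutator v (iter_commutator v k y)"
  by (simp_all add: iter_commutator_def)

lemma iter_commutator_Suc': "iter_commutator v (Suc k) y = iter_commutator v k (commutator v y)"
  by (simp add: iter_commutator_def funpow_swap1)

lemma commutator_zero [simp]: "commutator v 0 = 0"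
  and commutator_mult: "commutator v (x * y) = commutator v x * y + x * commutator v y"
  by (simp_all add: commutator_def algebra_simps)

lemma iter_commutator_sum:
  "iter_commutator v k (\<Sum>i\<in>A. g i) = (\<Sum>i\<in>A. iter_commutator v k (g i))"
proof (induction k)
  case (Suc k)
  have "commutator v (\<Sum>i\<in>A. h i) = (\<Sum>i\<in>A. commutator v (h i))" for h :: "'b \<Rightarrow> 'a"
    by (simp add: commutator_def sum_distrib_left sum_distrib_right sum_subtractf)
  with Suc show ?case by (simp add: iter_commutator_Suc)
qed simp

text \<open>An element commuting with \<open>v\<close> is a constant of the derivation, so it can be
  pulled out.\<close>

lemma iter_commutator_mult_right:
  assumes "commutator v u = 0"
  shows "iter_commutator v k (z * u) = iter_commutator v k z * u"
  by (induction k) (simp_all add: iter_commutator_Suc commutator_mult assms)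

lemma commutator_power:
  fixes v :: "'a::{ring,monoid_mult}"
  shows "commutator v (v ^ m) = 0"
  by (simp add: commutator_def power_commutes)

lemma dword_val_Cons: "dword_val v x (p # l) = iter_commutator v (snd p) (x (fst p)) * dword_val v x l"
  and dword_val_append: "dword_val v x (l @ l') = dword_val v x l * dword_val v x l'"
  and dword_val_Nil [simp]: "dword_val v x [] = 1"
  by (simp_all add: dword_val_def split_beta)

lemma dword_val_cong:
  assumes "\<And>j. j \<in> fst ` set l \<Longrightarrow> x j = y j"
  shows "dword_val v x l = dword_val v y l"
  unfolding dword_val_def using assms by (intro arg_cong[of _ _ prod_list] map_cong) force+

text \<open>Leibniz rule: differentiating a word raises one exponent at a time.\<close>

lemma commutator_dword_val: "commutator v (dword_val v x l) = (\<Sum>j<length l. dword_val v x (inc j l))"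
proof (induction l)
  case Nil
  then show ?case by (simp add: commutator_def)
next
  case (Cons p l)
  have "dword_val v x (inc (Suc j) (p # l)) =
      iter_commutator v (snd p) (x (fst p)) * dword_val v x (inc j l)" for j
    by (simp add: inc_def dword_val_Cons)
  moreover have "dword_val v x (inc 0 (p # l)) =
      commutator v (iter_commutator v (snd p) (x (fst p))) * dword_val v x l"
    by (simp add: inc_def dword_val_Cons iter_commutator_Suc)
  ultimately show ?case
    by (simp only: dword_val_Cons commutator_mult Cons.IH length_Cons sum.lessThan_Suc_shift
        sum_distrib_left)
qed

lemma commutator_dword_val_take:
  assumes "i \<le> length l"
  shows "commutator v (dword_val v x (take i l)) = (\<Sum>j<i. dword_val v x (take i (inc j l)))"
  using assms by (simp add: commutator_dword_val inc_def take_update_swap)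

lemma drop_inc: "j < i \<Longrightarrow> drop i (inc j l) = drop i l"
  by (simp add: inc_def)


section \<open>Differentiating prefixes\<close>

text \<open>The Leibniz rule transposed to coefficients: \<open>l\<close> arises by
  \<open>inc j\<close> from \<open>dec j l\<close>, so its new coefficient collects those of its
  predecessors in the first \<open>i\<close> positions. A word with exponent 0 at \<open>j\<close>
  has no predecessor there, while \<open>dec\<close> would truncate; hence the guard.\<close>

definition prefix_deriv :: "nat \<Rightarrow> (dword \<Rightarrow> 'f::field) \<Rightarrow> dword \<Rightarrow> 'f"
  where "prefix_deriv i g l = (\<Sum>j<i. if snd (l ! j) = 0 then 0 else g (dec j l))"

lemma prefix_deriv_funpow_Suc:
  "(prefix_deriv i ^^ Suc k) g l =
    (\<Sum>j<i. if snd (l ! j) = 0 then 0 else (prefix_deriv i ^^ k) g (dec j l))"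
  by (simp only: funpow.simps o_apply prefix_deriv_def[of i "(prefix_deriv i ^^ k) g"])

lemma prefix_deriv_funpow_zero:
  assumes "\<And>l. l \<in> dwords S r \<Longrightarrow> g l = 0" "i \<le> card S" "l \<in> dwords S (r + k)"
  shows "(prefix_deriv i ^^ k) g l = 0"
  using assms(3)
proof (induction k arbitrary: l)
  case 0
  then show ?case using assms(1) by simp
next
  case (Suc k)
  have "(prefix_deriv i ^^ k) g (dec q l) = 0" if "q < i" "snd (l ! q) \<noteq> 0" for q
    using that Suc.prems assms(2) by (intro Suc.IH dec_in_dwords) auto
  then show ?case
    by (auto simp: prefix_deriv_funpow_Suc simp del: funpow.simps intro!: sum.neutral)
qed

text \<open>Passing to predecessors changes only positions below \<open>i\<close>, so the exponent
  at \<open>j\<close> stays above \<open>d\<close> all the way back.\<close>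

lemma prefix_deriv_funpow_bounded:
  assumes "\<And>l. l \<in> dwords S r \<Longrightarrow> snd (l ! j) > d \<Longrightarrow> g l = 0" "i \<le> j" "j < card S"
    and "l \<in> dwords S (r + k)" "snd (l ! j) > d"
  shows "(prefix_deriv i ^^ k) g l = 0"
  using assms(4,5)
proof (induction k arbitrary: l)
  case 0
  then show ?case using assms(1) by simp
next
  case (Suc k)
  have "(prefix_deriv i ^^ k) g (dec q l) = 0" if "q < i" "snd (l ! q) \<noteq> 0" for q
    using that Suc.prems assms(2,3) length_dwords[OF Suc.prems(1)]
    by (intro Suc.IH) (auto simp: dec_in_dwords snd_nth_dec)
  then show ?case
    by (auto simp: prefix_deriv_funpow_Suc simp del: funpow.simps intro!: sum.neutral)
qed

text \<open>Each step back lowers position \<open>j\<close> by at most one. Hence exponents above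
  \<open>d + k\<close> never come down to the support of \<open>g\<close>, and exponent
  \<open>d + k\<close> does so only by lowering \<open>j\<close> in every step: a single path, with
  no cancellation.\<close>

lemma prefix_deriv_funpow_top:
  assumes "\<And>l. l \<in> dwords S r \<Longrightarrow> snd (l ! j) > d \<Longrightarrow> g l = 0" "j < card S"
  shows "(\<forall>l\<in>dwords S (r + k). snd (l ! j) > d + k \<longrightarrow> (prefix_deriv (Suc j) ^^ k) g l = 0) \<and>
    (\<forall>l\<in>dwords S r. snd (l ! j) = d \<longrightarrow> (prefix_deriv (Suc j) ^^ k) g ((inc j ^^ k) l) = g l)"
proof (induction k)
  case 0
  then show ?case using assms(1) by simp
next
  case (Suc k)
  let ?h = "(prefix_deriv (Suc j) ^^ k) g"
  have zero: "?h (dec q l) = 0"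
    if "l \<in> dwords S (r + Suc k)" "q < j" "snd (l ! q) \<noteq> 0" "snd (l ! j) > d + k" for q l
    using that Suc.IH assms(2) length_dwords[OF that(1)] by (auto simp: dec_in_dwords snd_nth_dec)
  have inck: "(inc j ^^ k') l \<in> dwords S (r + k') \<and> snd ((inc j ^^ k') l ! j) = d + k'"
    if "l \<in> dwords S r" "snd (l ! j) = d" for l k'
    using that assms(2) by (induction k') (auto simp: inc_in_dwords snd_nth_inc length_dwords)
  have "(prefix_deriv (Suc j) ^^ Suc k) g l = 0"
    if "l \<in> dwords S (r + Suc k)" "snd (l ! j) > d + Suc k" for l
  proof -
    have "?h (dec j l) = 0"
      using that Suc.IH assms(2) length_dwords[OF that(1)] by (auto simp: dec_in_dwords snd_nth_dec)
    then show ?thesis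
      using that zero[OF that(1)] by (auto simp: prefix_deriv_funpow_Suc simp del: funpow.simps intro!: sum.neutral)
  qed
  moreover have "(prefix_deriv (Suc j) ^^ Suc k) g ((inc j ^^ Suc k) l) = g l"
    if "l \<in> dwords S r" "snd (l ! j) = d" for l
  proof -
    let ?m = "(inc j ^^ k) l"
    have "(\<Sum>q<j. if snd (inc j ?m ! q) = 0 then 0 else ?h (dec q (inc j ?m))) = 0"
      using inck[OF that, of "Suc k"] zero[of "inc j ?m"] by (auto intro!: sum.neutral)
    moreover have "j < length ?m"
      using inck[OF that, of k] assms(2) length_dwords by metis
    ultimately have "(prefix_deriv (Suc j) ^^ Suc k) g (inc j ?m) = ?h ?m"
      unfolding prefix_deriv_funpow_Suc sum.lessThan_Suc by (simp add: snd_nth_inc)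
    then show ?thesis using Suc.IH that by simp
  qed
  ultimately show ?case by blast
qed

text \<open>Let \<open>i\<close> be maximal with \<open>\<mu> i \<noteq> 0\<close>. Differentiating prefixes of length less than \<open>i\<close> does not
  raise the exponent at position \<open>i - 1\<close>, so after more than \<open>r\<close> derivatives the words with the
  highest exponent there come from \<open>\<mu> i\<close> alone, and from its leading part only.\<close>

lemma ex_prefix_deriv_sum_nonzero:
  fixes \<mu> :: "nat \<Rightarrow> dword \<Rightarrow> 'f::field"
  assumes S: "finite S" and ex: "\<exists>l\<in>dwords S r. \<exists>i\<le>card S. \<mu> i l \<noteq> 0"
  shows "\<exists>k. \<exists>l\<in>dwords S (r + k). (\<Sum>i\<le>card S. (prefix_deriv i ^^ k) (\<mu> i) l) \<noteq> 0"
proof -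
  define P where "P i \<longleftrightarrow> i \<le> card S \<and> (\<exists>l\<in>dwords S r. \<mu> i l \<noteq> 0)" for i
  define I where "I = Greatest P"
  have ex: "\<exists>i. P i" and bound: "\<And>i. P i \<Longrightarrow> i \<le> card S"
    using ex unfolding P_def by blast+
  have PI: "P I" unfolding I_def using ex bound by (rule GreatestI_ex_nat)
  have max: "i \<le> I" if "P i" for i unfolding I_def using that bound by (rule Greatest_le_nat)
  have above: "(prefix_deriv i ^^ k) (\<mu> i) l = 0"
    if "i \<le> card S" "i > I" "l \<in> dwords S (r + k)" for i k l
    using that max[of i] by (intro prefix_deriv_funpow_zero[where S = S and r = r]) (auto simp: P_def)
  have reduce: "(\<Sum>i\<le>card S. (prefix_deriv i ^^ k) (\<mu> i) l) = (prefix_deriv I ^^ k) (\<mu> I) l"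
    if "\<And>i. i < I \<Longrightarrow> (prefix_deriv i ^^ k) (\<mu> i) l = 0" "l \<in> dwords S (r + k)" for k l
  proof -
    have "(\<Sum>i\<le>card S. (prefix_deriv i ^^ k) (\<mu> i) l) = (\<Sum>i\<in>{I}. (prefix_deriv i ^^ k) (\<mu> i) l)"
    proof (rule sum.mono_neutral_right)
      show "\<forall>i\<in>{..card S} - {I}. (prefix_deriv i ^^ k) (\<mu> i) l = 0"
        using that above by (metis Diff_iff atMost_iff insertCI linorder_neqE_nat)
    qed (use PI in \<open>auto simp: P_def\<close>)
    then show ?thesis by simp
  qed
  show ?thesis
  proof (cases I)
    \<comment> \<open>The empty prefix has derivative zero, so no derivative may be taken; with
      \<open>k = 0\<close> only the term \<open>I\<close> remains by maximality.\<close>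
    case 0
    obtain l where "l \<in> dwords S r" "\<mu> I l \<noteq> 0" using PI by (auto simp: P_def)
    then show ?thesis using reduce[of 0 l] 0 by (intro exI[of _ 0] bexI[of _ l]) auto
  next
    case (Suc j)
    have j: "j < card S" using PI Suc by (simp add: P_def)
    let ?T = "{l \<in> dwords S r. \<mu> I l \<noteq> 0}"
    have T: "finite ?T" "?T \<noteq> {}" using PI finite_dwords[OF S] by (auto simp: P_def)
    define d where "d = Max ((\<lambda>l. snd (l ! j)) ` ?T)"
    have "d \<in> (\<lambda>l. snd (l ! j)) ` ?T" unfolding d_def using T by (intro Max_in) auto
    then obtain l where l: "l \<in> dwords S r" "\<mu> I l \<noteq> 0" "snd (l ! j) = d" by auto
    have d: "\<mu> I l' = 0" if "l' \<in> dwords S r" "snd (l' ! j) > d" for l'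
      using that T(1) Max_ge[of "(\<lambda>l. snd (l ! j)) ` ?T" "snd (l' ! j)"] unfolding d_def
      by (metis (mono_tags, lifting) finite_imageI image_eqI leD mem_Collect_eq)
    \<comment> \<open>After \<open>Suc r\<close> increments the exponent at \<open>j\<close> exceeds
      every exponent of a word of total order \<open>r\<close>, which silences all
      \<open>i < I\<close>.\<close>
    let ?k = "Suc r" and ?m = "(inc j ^^ Suc r) l"
    have m: "(inc j ^^ k) l \<in> dwords S (r + k) \<and> snd ((inc j ^^ k) l ! j) = d + k" for k
      using l j by (induction k) (auto simp: inc_in_dwords snd_nth_inc length_dwords)
    have m': "?m \<in> dwords S (r + ?k)" "snd (?m ! j) > r" using m[of ?k] by auto
    have zero: "(prefix_deriv i ^^ ?k) (\<mu> i) ?m = 0" if "i < I" for i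
    proof (rule prefix_deriv_funpow_bounded[where S = S and r = r and d = r and j = j])
      show "\<mu> i l' = 0" if "l' \<in> dwords S r" "snd (l' ! j) > r" for l'
        using that snd_nth_le_dwords[OF that(1), of j] length_dwords[OF that(1)] j by simp
    qed (use that Suc j m' in auto)
    have top: "(prefix_deriv I ^^ ?k) (\<mu> I) ?m = \<mu> I l"
      using prefix_deriv_funpow_top[where k = ?k, THEN conjunct2, rule_format, OF d j l(1,3)]
      by (simp only: Suc)
    have "(\<Sum>i\<le>card S. (prefix_deriv i ^^ ?k) (\<mu> i) ?m) \<noteq> 0"
      using l(2) by (subst reduce) (use zero top m'(1) in \<open>simp_all del: funpow.simps\<close>)
    then show ?thesis by (intro exI[of _ ?k] bexI[OF _ m'(1)])
  qed
qed

lemma in_commutator_coreD: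
  assumes "a \<in> commutator_core v"
  shows "\<exists>y. iter_commutator v k y = a"
proof (cases "k = 0")
  case False
  then show ?thesis using assms by (fastforce simp: commutator_core_def)
qed simp

section \<open>Words given by a permutation and a tuple of exponents\<close>

text \<open>A tuple \<open>b\<close> is indexed by variables and a word by positions, so position
  \<open>k\<close> carries the exponent \<open>b (\<sigma> k)\<close>.\<close>

definition exponent_word :: "nat \<Rightarrow> (nat \<Rightarrow> nat) \<times> (nat \<Rightarrow> nat) \<Rightarrow> dword"
  where "exponent_word n = (\<lambda>(\<sigma>, b). map (\<lambda>k. (\<sigma> k, b (\<sigma> k))) [1..<n + 1])"

lemma length_exponent_word [simp]: "length (exponent_word n p) = n"
  by (simp add: exponent_word_def split_beta)

lemma nth_exponent_word:
  "k < n \<Longrightarrow> exponent_word n (\<sigma>, b) ! k = (\<sigma> (Suc k), b (\<sigma> (Suc k)))"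
  by (simp add: exponent_word_def del: upt_Suc)

lemma exponent_word_in_dwords:
  assumes "\<sigma> permutes {1..n}" "b \<in> weak_compositions n r"
  shows "exponent_word n (\<sigma>, b) \<in> dwords {1..n} r"
proof -
  have s: "map fst (exponent_word n (\<sigma>, b)) = map \<sigma> [1..<n + 1]"
    and t: "map snd (exponent_word n (\<sigma>, b)) = map (\<lambda>k. b (\<sigma> k)) [1..<n + 1]"
    by (simp_all add: exponent_word_def comp_def del: upt_Suc)
  have set: "set [1..<n + 1] = {1..n}" by auto
  have "sum_list (map (\<lambda>k. b (\<sigma> k)) [1..<n + 1]) = (\<Sum>k=1..n. b (\<sigma> k))"
    by (simp only: sum_list_distinct_conv_sum_set distinct_upt set)
  also have "\<dots> = r"
    using assms sum.permute[OF assms(1), of b] by (simp add: weak_compositions_def comp_def)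
  finally show ?thesis
    using permutes_inj_on[OF assms(1)] permutes_image[OF assms(1)]
    unfolding dwords_def mem_Collect_eq s t by (simp only: distinct_map set_map set distinct_upt)
qed

text \<open>The word determines both functions on \<open>{1..n}\<close> only; outside, a permutation
  is the identity and a tuple is extensional.\<close>

lemma inj_on_exponent_word:
  "inj_on (exponent_word n) ({\<sigma>. \<sigma> permutes {1..n}} \<times> weak_compositions n r)"
proof (rule inj_onI, clarify)
  fix \<sigma> b \<sigma>' b'
  assume p: "\<sigma> permutes {1..n}" "\<sigma>' permutes {1..n}"
    and b: "b \<in> weak_compositions n r" "b' \<in> weak_compositions n r"
    and eq: "exponent_word n (\<sigma>, b) = exponent_word n (\<sigma>', b')"
  have *: "\<sigma> k = \<sigma>' k \<and> b (\<sigma> k) = b' (\<sigma>' k)" if "k \<in> {1..n}" for k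
    using arg_cong[OF eq, of "\<lambda>l. l ! (k - 1)"] that
    by (cases k) (auto simp: nth_exponent_word)
  have \<sigma>: "\<sigma> = \<sigma>'"
  proof
    fix k show "\<sigma> k = \<sigma>' k"
      using * p by (cases "k \<in> {1..n}") (auto simp: permutes_not_in)
  qed
  have "b = b'"
  proof (rule PiE_ext[where k = "{1..n}" and s = "\<lambda>_. UNIV"])
    show "b j = b' j" if "j \<in> {1..n}" for j
    proof -
      have "j \<in> \<sigma> ` {1..n}" using that unfolding permutes_image[OF p(1)] .
      then obtain k where k: "k \<in> {1..n}" "j = \<sigma> k" by (rule imageE)
      show ?thesis using *[OF k(1)] unfolding k(2) by argo
    qed
  qed (use b in \<open>simp_all add: weak_compositions_def\<close>)
  then show "\<sigma> = \<sigma>' \<and> b = b'" by (intro conjI \<sigma>)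
qed

text \<open>Coefficients are transported along the injection \<open>exponent_word n\<close>. The
  default 0 off its image lets sums run over all of \<open>dwords {1..n} r\<close>.\<close>

definition word_coeff :: "nat \<Rightarrow> nat \<Rightarrow> ((nat \<Rightarrow> nat) \<times> (nat \<Rightarrow> nat) \<Rightarrow> 'f::zero) \<Rightarrow> dword \<Rightarrow> 'f"
  where "word_coeff n r g l =
    (let T = {\<sigma>. \<sigma> permutes {1..n}} \<times> weak_compositions n r
     in if l \<in> exponent_word n ` T then g (inv_into T (exponent_word n) l) else 0)"

lemma word_coeff_exponent_word:
  assumes "\<sigma> permutes {1..n}" "b \<in> weak_compositions n r"
  shows "word_coeff n r g (exponent_word n (\<sigma>, b)) = g (\<sigma>, b)"
proof -
  let ?T = "{\<sigma>. \<sigma> permutes {1..n}} \<times> weak_compositions n r"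
  have "(\<sigma>, b) \<in> ?T" using assms by simp
  then show ?thesis
    unfolding word_coeff_def Let_def by (simp only: inv_into_f_f[OF inj_on_exponent_word] imageI if_True)
qed


section \<open>Attaining the commutator core\<close>

context unital_algebra
begin

lemma commutator_scale: "commutator v (c *s y) = c *s commutator v y"
  by (simp add: commutator_def scale_mult_left scale_mult_right scale_right_diff_distrib)

lemma iter_commutator_scale: "iter_commutator v k (c *s y) = c *s iter_commutator v k y"
  by (induction k) (simp_all add: iter_commutator_Suc commutator_scale)

definition word_sum :: "'a \<Rightarrow> (nat \<Rightarrow> 'a) \<Rightarrow> nat set \<Rightarrow> nat \<Rightarrow> (dword \<Rightarrow> 'f) \<Rightarrow> 'a"
  where "word_sum v x S r c = (\<Sum>l\<in>dwords S r. c l *s dword_val v x l)"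

text \<open>Common form of two situations: the sum left after eliminating a variable, and the value
  of a polynomial of type two. The index \<open>i\<close> is the gap that receives \<open>u\<close>,
  from 0 (in front) to \<open>card S\<close> (at the end).\<close>

definition insert_sum ::
    "'a \<Rightarrow> (nat \<Rightarrow> 'a) \<Rightarrow> 'a \<Rightarrow> nat set \<Rightarrow> nat \<Rightarrow> (nat \<Rightarrow> dword \<Rightarrow> 'f) \<Rightarrow> 'a"
  where "insert_sum v x u S r \<mu> =
    (\<Sum>i\<le>card S. \<Sum>l\<in>dwords S r. \<mu> i l *s (dword_val v x (take i l) * u * dword_val v x (drop i l)))"

text \<open>For fixed \<open>j\<close>, \<open>inc j\<close> is a bijection from words of order
  \<open>r\<close> onto words of order \<open>Suc r\<close> with nonzero exponent at
  \<open>j\<close>, with inverse \<open>dec j\<close>.\<close>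

lemma sum_prefix_deriv:
  assumes "i \<le> card S"
  shows "(\<Sum>l\<in>dwords S r. \<Sum>j<i. g l *s H (inc j l)) =
    (\<Sum>l\<in>dwords S (Suc r). prefix_deriv i g l *s H l)"
proof -
  have "(\<Sum>l\<in>dwords S r. g l *s H (inc j l)) =
      (\<Sum>l\<in>dwords S (Suc r). (if snd (l ! j) = 0 then 0 else g (dec j l)) *s H l)"
    (is "?L = ?R") if "j < i" for j
  proof (cases "finite S")
    case True
    have j: "j < card S" using that assms by simp
    have "?R = (\<Sum>l\<in>{l \<in> dwords S (Suc r). snd (l ! j) \<noteq> 0}. g (dec j l) *s H l)"
      using True by (intro sum.mono_neutral_cong_right) (auto simp: finite_dwords)
    also have "\<dots> = ?L"
      using j by (intro sum.reindex_bij_witness[of _ "inc j" "dec j"])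
        (auto simp: inc_in_dwords dec_in_dwords snd_nth_inc inc_dec length_dwords)
    finally show ?thesis by simp
  \<comment> \<open>An infinite \<open>S\<close> has \<open>card S = 0\<close>, so there is no
    \<open>j < i\<close>.\<close>
  qed (use assms that in auto)
  then have "(\<Sum>j<i. \<Sum>l\<in>dwords S r. g l *s H (inc j l)) =
      (\<Sum>j<i. \<Sum>l\<in>dwords S (Suc r). (if snd (l ! j) = 0 then 0 else g (dec j l)) *s H l)"
    by simp
  then show ?thesis
    unfolding prefix_deriv_def scale_sum_left by (simp add: sum.swap[of _ "{..<i}"])
qed

text \<open>One commutator is expanded by the Leibniz rule, which leaves the suffix alone, and is
  absorbed into the coefficients; the induction therefore varies \<open>r\<close> and
  \<open>g\<close>.\<close>

lemma sum_iter_commutator_prefix: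
  assumes "i \<le> card S"
  shows "(\<Sum>l\<in>dwords S r.
      g l *s (iter_commutator v k (dword_val v x (take i l)) * dword_val v x (drop i l))) =
    word_sum v x S (r + k) ((prefix_deriv i ^^ k) g)"
proof (induction k arbitrary: r g)
  case 0
  show ?case by (simp add: word_sum_def flip: dword_val_append)
next
  case (Suc k)
  let ?H = "\<lambda>l. iter_commutator v k (dword_val v x (take i l)) * dword_val v x (drop i l)"
  have "g l *s (iter_commutator v (Suc k) (dword_val v x (take i l)) * dword_val v x (drop i l)) =
      (\<Sum>j<i. g l *s ?H (inc j l))" if "l \<in> dwords S r" for l
    using assms length_dwords[OF that]
    by (simp add: iter_commutator_Suc' commutator_dword_val_take iter_commutator_sum sum_distrib_right
        drop_inc scale_sum_right)
  then show ?case
    using Suc.IH[where r = "Suc r" and g = "prefix_deriv i g"]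
      sum_prefix_deriv[OF assms, where g = g and H = ?H and r = r]
    by (simp add: funpow_swap1)
qed

text \<open>Moving powers of \<open>v\<close> to the left past a prefix \<open>P\<close> by \<open>P v = v P - [v, P]\<close>; for the
  least \<open>m\<close> for which the \<open>m\<close>-th derivatives of prefixes do not cancel, only these survive.\<close>

lemma insert_sum_power:
  assumes "\<And>k l. k < m \<Longrightarrow> l \<in> dwords S (r + k) \<Longrightarrow> (\<Sum>i\<le>card S. (prefix_deriv i ^^ k) (\<mu> i) l) = 0"
  shows "insert_sum v x (v ^ m) S r \<mu> =
    word_sum v x S (r + m) (\<lambda>l. (- 1) ^ m * (\<Sum>i\<le>card S. (prefix_deriv i ^^ m) (\<mu> i) l))"
proof -
  \<comment> \<open>\<open>F a k\<close> has \<open>k\<close> derivatives on each prefix and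
    \<open>a\<close> factors \<open>v\<close> still standing behind it.\<close>
  define F where "F a k = (\<Sum>i\<le>card S. \<Sum>l\<in>dwords S r. \<mu> i l *s
    (iter_commutator v k (dword_val v x (take i l)) * v ^ a * dword_val v x (drop i l)))" for a k
  have F0: "F 0 k = word_sum v x S (r + k) (\<lambda>l. \<Sum>i\<le>card S. (prefix_deriv i ^^ k) (\<mu> i) l)" for k
  proof -
    have "F 0 k = (\<Sum>i\<le>card S. word_sum v x S (r + k) ((prefix_deriv i ^^ k) (\<mu> i)))"
      unfolding F_def by (intro sum.cong) (simp_all add: sum_iter_commutator_prefix)
    then show ?thesis
      unfolding word_sum_def scale_sum_left by (simp only: sum.swap[of _ "{..card S}"])
  qed
  have F_Suc: "F (Suc a) k = v * F a k - F a (Suc k)" for a k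
  proof -
    have "p * v ^ Suc a * q = v * (p * v ^ a * q) - commutator v p * v ^ a * q" for p q
      by (simp add: commutator_def left_diff_distrib mult.assoc)
    then show ?thesis
      by (simp add: F_def iter_commutator_Suc sum_distrib_left scale_mult_right sum_subtractf
          scale_right_diff_distrib)
  qed
  \<comment> \<open>Everything with \<open>a + k < m\<close> vanishes. On the line
    \<open>a + k = m\<close> the summand with \<open>v\<close> in front therefore drops out of
    \<open>F_Suc\<close>, and each step only changes the sign.\<close>
  have "(a + k < m \<longrightarrow> F a k = 0) \<and> (a + k = m \<longrightarrow> F a k = ((- 1) ^ a) *s F 0 m)" for a k
  proof (induction a arbitrary: k)
    case 0
    show ?case unfolding F0 word_sum_def using assms by (auto intro: sum.neutral)
  next
    case (Suc a)
    show ?case using Suc[of k] Suc[of "Suc k"] by (auto simp: F_Suc)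
  qed
  from this[of m 0] have "F m 0 = ((- 1) ^ m) *s F 0 m" by (simp only: add_0_right)
  moreover have "insert_sum v x (v ^ m) S r \<mu> = F m 0"
    by (simp add: insert_sum_def F_def)
  ultimately show ?thesis by (simp add: F0 word_sum_def scale_sum_right)
qed

section \<open>Elimination of variables by induction\<close>

text \<open>The induction hypothesis ranges over all orders and coefficients, since eliminating a
  variable changes both.\<close>

definition core_attained :: "'a \<Rightarrow> nat set \<Rightarrow> bool"
  where "core_attained v S \<longleftrightarrow> (\<forall>r c. \<forall>a\<in>commutator_core v.
    (\<exists>l\<in>dwords S r. c l \<noteq> 0) \<longrightarrow> (\<exists>x. word_sum v x S r c = a))"

text \<open>The exponent \<open>m\<close> is the least order at which the differentiated
  coefficients do not cancel. Inserting \<open>v ^ m\<close> then gives a nonzero combination of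
  words over \<open>S\<close>, to which \<open>core_attained v S\<close> applies.\<close>

lemma core_attained_insert_sum:
  assumes "core_attained v S" "finite S" "a \<in> commutator_core v"
    and "\<exists>l\<in>dwords S r. \<exists>i\<le>card S. \<mu> i l \<noteq> 0"
  shows "\<exists>x m. insert_sum v x (v ^ m) S r \<mu> = a"
proof -
  define P where "P k \<longleftrightarrow>
    (\<exists>l\<in>dwords S (r + k). (\<Sum>i\<le>card S. (prefix_deriv i ^^ k) (\<mu> i) l) \<noteq> 0)" for k
  define m where "m = Least P"
  have "\<exists>k. P k" using ex_prefix_deriv_sum_nonzero[OF assms(2,4)] unfolding P_def .
  then have m: "P m" "\<And>k. k < m \<Longrightarrow> \<not> P k"
    unfolding m_def using LeastI_ex[of P] not_less_Least[of _ P] by blast+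
  then have "\<exists>l\<in>dwords S (r + m). (- 1) ^ m * (\<Sum>i\<le>card S. (prefix_deriv i ^^ m) (\<mu> i) l) \<noteq> 0"
    by (auto simp: P_def)
  then obtain x where "word_sum v x S (r + m)
      (\<lambda>l. (- 1) ^ m * (\<Sum>i\<le>card S. (prefix_deriv i ^^ m) (\<mu> i) l)) = a"
    using assms(1,3) unfolding core_attained_def by meson
  moreover have "insert_sum v x (v ^ m) S r \<mu> = word_sum v x S (r + m)
      (\<lambda>l. (- 1) ^ m * (\<Sum>i\<le>card S. (prefix_deriv i ^^ m) (\<mu> i) l))"
    by (rule insert_sum_power) (use m(2) in \<open>auto simp: P_def\<close>)
  ultimately show ?thesis by metis
qed

text \<open>There is only the word \<open>[(j, r)]\<close>, so an \<open>r\<close>-fold preimage of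
  \<open>a\<close> is divided by its coefficient.\<close>

lemma core_attained_singleton: "core_attained v {j}"
  unfolding core_attained_def
proof (intro allI ballI impI)
  fix r a and c :: "dword \<Rightarrow> 'f"
  assume a: "a \<in> commutator_core v" and ex: "\<exists>l\<in>dwords {j} r. c l \<noteq> 0"
  have W: "dwords {j} r = {[(j, r)]}"
  proof
    show "dwords {j} r \<subseteq> {[(j, r)]}"
    proof
      fix l assume l: "l \<in> dwords {j} r"
      then obtain p where "l = [p]" using length_dwords[OF l] by (auto simp: length_Suc_conv)
      with l show "l \<in> {[(j, r)]}" by (cases p) (auto simp: dwords_def)
    qed
  qed (simp add: dwords_def)
  obtain y where "iter_commutator v r y = a" using in_commutator_coreD[OF a] by blast
  then have "word_sum v (\<lambda>_. inverse (c [(j, r)]) *s y) {j} r c = a"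
    using ex by (simp add: word_sum_def W dword_val_Cons iter_commutator_scale)
  then show "\<exists>x. word_sum v x {j} r c = a" by blast
qed

text \<open>Substituting \<open>z u\<close> for the new variable, where \<open>[v, z]\<^sub>B = 1\<close> for its least exponent \<open>B\<close>
  and \<open>u\<close> commutes with \<open>v\<close>, kills the higher exponents and turns exponent \<open>B\<close> into \<open>u\<close>.\<close>

lemma word_sum_insert:
  assumes S: "finite S" "j \<notin> S" and z: "iter_commutator v B z = 1" and u: "commutator v u = 0"
    and low: "\<And>l b. l \<in> dwords (insert j S) r \<Longrightarrow> (j, b) \<in> set l \<Longrightarrow> b < B \<Longrightarrow> c l = 0"
    and B: "B \<le> r"
  shows "word_sum v (x(j := z * u)) (insert j S) r c =
    insert_sum v x u S (r - B) (\<lambda>i l. c (take i l @ (j, B) # drop i l))"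
proof -
  let ?x = "x(j := z * u)"
  have D: "iter_commutator v B (z * u) = u"
    by (simp add: iter_commutator_mult_right[OF u] z)
  have high: "iter_commutator v b (z * u) = 0" if "b > B" for b
    using that
  proof (induction b)
    case (Suc b)
    then show ?case using D u
      by (cases "b = B") (auto simp: iter_commutator_Suc)
  qed simp
  \<comment> \<open>Only words in which \<open>j\<close> has exponent exactly \<open>B\<close>
    survive: smaller exponents have coefficient 0, larger ones a zero factor.\<close>
  let ?T = "{l \<in> dwords (insert j S) r. (j, B) \<in> set l}"
  have vanish: "c l *s dword_val v ?x l = 0" if l: "l \<in> dwords (insert j S) r" "(j, B) \<notin> set l" for l
  proof -
    have "j \<in> fst ` set l" using l(1) by (simp add: dwords_def)
    then obtain b where b: "(j, b) \<in> set l" by auto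
    show ?thesis
    proof (cases "b < B")
      case True
      then show ?thesis using low[OF l(1) b] by simp
    next
      case False
      then have "b > B" using b l(2) by (metis linorder_neqE_nat)
      obtain p q where "l = p @ (j, b) # q" using b by (meson split_list)
      then have "dword_val v ?x l = 0"
        using high[OF \<open>b > B\<close>] by (simp add: dword_val_append dword_val_Cons)
      then show ?thesis by simp
    qed
  qed
  have "word_sum v ?x (insert j S) r c = (\<Sum>l\<in>?T. c l *s dword_val v ?x l)"
    unfolding word_sum_def using S vanish by (intro sum.mono_neutral_right) (auto simp: finite_dwords)
  also have "\<dots> = (\<Sum>(i, l)\<in>{..card S} \<times> dwords S (r - B).
      c (take i l @ (j, B) # drop i l) *s (dword_val v x (take i l) * u * dword_val v x (drop i l)))"
  proof (rule sum.reindex_bij_betw[symmetric, THEN trans, OF _ sum.cong[OF refl]])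
    let ?f = "\<lambda>(i, l). take i l @ (j, B) # drop i l"
    show "bij_betw ?f ({..card S} \<times> dwords S (r - B)) ?T"
      unfolding bij_betw_def
    proof
      \<comment> \<open>Since \<open>j\<close> is not in \<open>S\<close>, the inserted letter
        occurs once and marks the cut; the length of the prefix gives back \<open>i\<close>.\<close>
      have eq: "i = i' \<and> l = l'"
        if "l \<in> dwords S (r - B)" "l' \<in> dwords S (r - B)" "i \<le> card S" "i' \<le> card S"
          "take i l @ (j, B) # drop i l = take i' l' @ (j, B) # drop i' l'" for i i' l l'
      proof -
        have "j \<notin> fst ` set l" "j \<notin> fst ` set l'"
          using that(1,2) S by (simp_all add: dwords_def)
        then have "(j, B) \<notin> set l" "(j, B) \<notin> set l'" by force+
        then have "(j, B) \<notin> set (take i l)" "(j, B) \<notin> set (drop i l)"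
          by (meson in_set_takeD in_set_dropD)+
        then have *: "take i l = take i' l' \<and> drop i l = drop i' l'"
          using that(5) by (metis append_Cons_eq_iff)
        then have "l = l'" by (metis append_take_drop_id)
        moreover have "length (take i l) = i" "length (take i' l') = i'"
          using that(3,4) length_dwords[OF that(1)] length_dwords[OF that(2)] by simp_all
        ultimately show ?thesis using * by metis
      qed
      show "inj_on ?f ({..card S} \<times> dwords S (r - B))"
      proof (rule inj_onI)
        fix s t
        assume st: "s \<in> {..card S} \<times> dwords S (r - B)" "t \<in> {..card S} \<times> dwords S (r - B)"
          "?f s = ?f t"
        obtain i l i' l' where "s = (i, l)" "t = (i', l')" by fastforce
        then show "s = t" using eq[of l l' i i'] st by simp
      qed
      show "?f ` ({..card S} \<times> dwords S (r - B)) = ?T"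
      proof (intro equalityI subsetI)
        fix l assume "l \<in> ?f ` ({..card S} \<times> dwords S (r - B))"
        then obtain i l' where l': "l' \<in> dwords S (r - B)" "l = take i l' @ (j, B) # drop i l'" by auto
        define p q where "p = take i l'" "q = drop i l'"
        then have "p @ q \<in> dwords S (r - B)" "l = p @ (j, B) # q" using l' by simp_all
        then show "l \<in> ?T" using S(2) B by (auto simp: dwords_def)
      next
        fix l assume l: "l \<in> ?T"
        then obtain p q where pq: "l = p @ (j, B) # q" by (auto dest: split_list)
        have "p @ q \<in> dwords S (r - B)"
          using l S by (auto simp: pq dwords_def)
        then show "l \<in> ?f ` ({..card S} \<times> dwords S (r - B))"
          using length_dwords[of "p @ q" S "r - B"]
          by (intro image_eqI[of _ _ "(length p, p @ q)"]) (auto simp: pq)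
      qed
    qed
    fix p assume p: "p \<in> {..card S} \<times> dwords S (r - B)"
    obtain i l where il: "p = (i, l)" by fastforce
    have "j \<notin> fst ` set l" using p S by (auto simp: il dwords_def)
    then have "j \<notin> fst ` set (take i l)" "j \<notin> fst ` set (drop i l)"
      using image_mono[OF set_take_subset, of fst i l] image_mono[OF set_drop_subset, of fst i l] by blast+
    then have "dword_val v ?x (take i l) = dword_val v x (take i l)"
      "dword_val v ?x (drop i l) = dword_val v x (drop i l)"
      by (intro dword_val_cong; metis fun_upd_other)+
    then show "c (?f p) *s dword_val v ?x (?f p) = (case p of (i, l) \<Rightarrow>
        c (take i l @ (j, B) # drop i l) *s (dword_val v x (take i l) * u * dword_val v x (drop i l)))"
      by (simp add: il dword_val_append dword_val_Cons D mult.assoc)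
  qed
  finally show ?thesis by (simp add: insert_sum_def sum.cartesian_product)
qed

lemma core_attained_insert:
  assumes one: "1 \<in> commutator_core v" and S: "finite S" "j \<notin> S" and IH: "core_attained v S"
  shows "core_attained v (insert j S)"
  unfolding core_attained_def
proof (intro allI ballI impI)
  fix r a and c :: "dword \<Rightarrow> 'f"
  assume a: "a \<in> commutator_core v" and ex: "\<exists>l\<in>dwords (insert j S) r. c l \<noteq> 0"
  define P where "P b \<longleftrightarrow> (\<exists>l\<in>dwords (insert j S) r. (j, b) \<in> set l \<and> c l \<noteq> 0)" for b
  \<comment> \<open>\<open>B\<close> is the least exponent of variable \<open>j\<close> in a word
    with nonzero coefficient.\<close>
  define B where "B = Least P"
  obtain l' where l': "l' \<in> dwords (insert j S) r" "c l' \<noteq> 0" using ex by blast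
  then have "j \<in> fst ` set l'" by (simp add: dwords_def)
  then obtain b where "(j, b) \<in> set l'" by auto
  then have "\<exists>b. P b" using l' unfolding P_def by blast
  then have PB: "P B" and min: "\<And>b. b < B \<Longrightarrow> \<not> P b"
    unfolding B_def using LeastI_ex[of P] not_less_Least[of _ P] by blast+
  then obtain l where l: "l \<in> dwords (insert j S) r" "(j, B) \<in> set l" "c l \<noteq> 0"
    by (auto simp: P_def)
  \<comment> \<open>Deleting \<open>(j, B)\<close> leaves a word over \<open>S\<close> whose gap
    \<open>length p\<close> carries the nonzero coefficient \<open>c l\<close>.\<close>
  obtain p q where pq: "l = p @ (j, B) # q" using l(2) by (meson split_list)
  have B: "B \<le> r" and pq': "p @ q \<in> dwords S (r - B)" using l(1) S(2) by (auto simp: pq dwords_def)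
  have "length p \<le> card S" using length_dwords[OF pq'] by simp
  then have "\<exists>l\<in>dwords S (r - B). \<exists>i\<le>card S. c (take i l @ (j, B) # drop i l) \<noteq> 0"
    using pq' l(3) pq by (intro bexI[of _ "p @ q"] exI[of _ "length p"]) auto
  then obtain x m where x: "insert_sum v x (v ^ m) S (r - B)
      (\<lambda>i l. c (take i l @ (j, B) # drop i l)) = a"
    using core_attained_insert_sum[OF IH S(1) a,
        of "r - B" "\<lambda>i l. c (take i l @ (j, B) # drop i l)"] by blast
  \<comment> \<open>This is where 1 has to lie in the core: \<open>z\<close> is a
    \<open>B\<close>-fold antiderivative of 1.\<close>
  obtain z where "iter_commutator v B z = 1" using in_commutator_coreD[OF one] by blast
  then have "word_sum v (x(j := z * v ^ m)) (insert j S) r c = a"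
    unfolding x[symmetric] by (intro word_sum_insert S commutator_power B) (use min P_def in blast)+
  then show "\<exists>x. word_sum v x (insert j S) r c = a" by blast
qed

text \<open>The induction starts at one variable; over the empty set a word sum is just a scalar
  multiple of 1.\<close>

lemma core_attained:
  assumes "1 \<in> commutator_core v" "finite S" "S \<noteq> {}"
  shows "core_attained v S"
  using assms(2,3)
  by (induction rule: finite_ne_induct)
    (simp_all add: core_attained_singleton core_attained_insert[OF assms(1)])

section \<open>Values of admissible polynomials\<close>

lemma explicit_eval_prod_list:
  assumes "u * v = v * u"
  shows "explicit_eval x u v (prod_list ps) = prod_list (map (explicit_eval x u v) ps)"
proof (induction ps)
  case Nil
  then show ?case using is_pc_eval_explicit_eval[OF assms, of x]
    by (simp add: is_pc_eval_def algebra_hom_def)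
qed (simp add: explicit_eval_mult[OF assms])

lemma explicit_eval_sum:
  "explicit_eval x u v (\<Sum>i\<in>I. g i) = (\<Sum>i\<in>I. explicit_eval x u v (g i))"
proof (induction I rule: infinite_finite_induct)
qed (simp_all add: explicit_eval_add, simp_all add: explicit_eval_def)

lemma explicit_eval_commutator:
  assumes "u * v = v * u"
  shows "explicit_eval x u v (commutator f g) =
    commutator (explicit_eval x u v f) (explicit_eval x u v g)"
proof -
  have "explicit_eval x u v (f * g) =
      explicit_eval x u v (commutator f g) + explicit_eval x u v (g * f)"
    by (simp add: commutator_def flip: explicit_eval_add)
  then show ?thesis by (simp add: commutator_def explicit_eval_mult[OF assms] eq_diff_eq)
qed

lemma explicit_eval_gen:
  assumes "u * v = v * u"
  shows "explicit_eval x u v (pc_gen l) = letter_val x u v l"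
  by (simp add: pc_gen_def explicit_eval_single monom_val_abs[OF assms])

lemma explicit_eval_Xb:
  assumes "u * v = v * u"
  shows "explicit_eval x u v (Xb b j) = iter_commutator v (b j) (x j)"
proof -
  have "explicit_eval x u v (iter_commutator pcV k (pcX j)) = iter_commutator v k (x j)" for k
    by (induction k) (simp_all add: iter_commutator_Suc explicit_eval_commutator[OF assms]
        explicit_eval_gen[OF assms])
  then show ?thesis by (simp add: Xb_def)
qed

lemma explicit_eval_word_b:
  assumes "u * v = v * u"
  shows "explicit_eval x u v (word_b b (map \<sigma> [1..<n + 1])) = dword_val v x (exponent_word n (\<sigma>, b))"
  by (simp add: word_b_def explicit_eval_prod_list[OF assms] dword_val_def exponent_word_def
      explicit_eval_Xb[OF assms] comp_def del: upt_Suc)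

text \<open>A commutator with \<open>u\<close> inside a word is the difference of two insertions of \<open>u\<close>.\<close>

lemma explicit_eval_word_bi:
  fixes b :: "nat \<Rightarrow> nat" and x :: "nat \<Rightarrow> 'a"
  assumes uv: "u * v = v * u" and \<sigma>: "\<sigma> permutes {1..n}" and i: "i < n"
  defines "l \<equiv> exponent_word n (\<sigma>, b)"
  defines "R \<equiv> \<lambda>k. dword_val v x (take k l) * u * dword_val v x (drop k l)"
  shows "explicit_eval x u v (word_bi b (\<sigma> (Suc i)) (map \<sigma> [1..<n + 1])) = R i - R (Suc i)"
proof -
  define y where "y = iter_commutator v (b (\<sigma> (Suc i))) (x (\<sigma> (Suc i)))"
  let ?g = "\<lambda>k. explicit_eval x u v (Xbi b (\<sigma> (Suc i)) (\<sigma> k))"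
  \<comment> \<open>By injectivity of \<open>\<sigma>\<close> only position \<open>Suc i\<close>
    carries the commutator with \<open>u\<close>; gaps \<open>i\<close> and \<open>Suc i\<close> lie
    directly before and after that factor.\<close>
  have g: "?g k = (if k = Suc i then commutator u y else iter_commutator v (b (\<sigma> k)) (x (\<sigma> k)))" for k
    using permutes_inj[OF \<sigma>]
    by (auto simp: Xbi_def explicit_eval_commutator[OF uv] explicit_eval_Xb[OF uv]
        explicit_eval_gen[OF uv] y_def dest: injD)
  have split: "[1..<n + 1] = [1..<Suc i] @ Suc i # [Suc (Suc i)..<n + 1]"
    using i upt_add_eq_append[of 1 "Suc i" "n - i"] by (simp add: upt_conv_Cons del: upt_Suc)
  let ?p = "\<lambda>k. (\<sigma> k, b (\<sigma> k))"
  have l: "l = map ?p [1..<Suc i] @ ?p (Suc i) # map ?p [Suc (Suc i)..<n + 1]"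
    unfolding l_def exponent_word_def split by (simp del: upt_Suc)
  let ?P = "dword_val v x (map ?p [1..<Suc i])"
    and ?Q = "dword_val v x (map ?p [Suc (Suc i)..<n + 1])"
  have "explicit_eval x u v (word_bi b (\<sigma> (Suc i)) (map \<sigma> [1..<n + 1])) =
      prod_list (map ?g [1..<Suc i]) * ?g (Suc i) * prod_list (map ?g [Suc (Suc i)..<n + 1])"
    unfolding split by (simp add: word_bi_def explicit_eval_prod_list[OF uv] comp_def explicit_eval_mult[OF uv]
        mult.assoc del: upt_Suc One_nat_def)
  also have "map ?g [1..<Suc i] = map (\<lambda>k. iter_commutator v (b (\<sigma> k)) (x (\<sigma> k))) [1..<Suc i]"
    by (intro map_cong) (auto simp: g simp del: upt_Suc)
  also have "map ?g [Suc (Suc i)..<n + 1] =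
      map (\<lambda>k. iter_commutator v (b (\<sigma> k)) (x (\<sigma> k))) [Suc (Suc i)..<n + 1]"
    by (intro map_cong) (auto simp: g simp del: upt_Suc)
  finally have "explicit_eval x u v (word_bi b (\<sigma> (Suc i)) (map \<sigma> [1..<n + 1])) =
      ?P * commutator u y * ?Q"
    by (simp add: g dword_val_def comp_def del: upt_Suc)
  moreover have "R i = ?P * u * (y * ?Q)"
    by (simp add: R_def l y_def dword_val_Cons del: upt_Suc)
  moreover have "R (Suc i) = ?P * y * u * ?Q"
    by (simp add: R_def l y_def dword_val_append dword_val_Cons del: upt_Suc)
  ultimately show ?thesis by (simp add: commutator_def algebra_simps)
qed

lemma sum_word_coeff:
  "(\<Sum>l\<in>dwords {1..n} r. word_coeff n r g l *s H l) =
    (\<Sum>\<sigma> | \<sigma> permutes {1..n}. \<Sum>b\<in>weak_compositions n r. g (\<sigma>, b) *s H (exponent_word n (\<sigma>, b)))"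
proof -
  let ?T = "{\<sigma>. \<sigma> permutes {1..n}} \<times> weak_compositions n r"
  have "(\<Sum>l\<in>dwords {1..n} r. word_coeff n r g l *s H l) =
      (\<Sum>l\<in>exponent_word n ` ?T. word_coeff n r g l *s H l)"
    by (intro sum.mono_neutral_right)
      (auto simp: finite_dwords exponent_word_in_dwords word_coeff_def Let_def simp del: One_nat_def)
  also have "\<dots> = (\<Sum>p\<in>?T. word_coeff n r g (exponent_word n p) *s H (exponent_word n p))"
    by (rule sum.reindex[OF inj_on_exponent_word, unfolded o_def])
  also have "\<dots> = (\<Sum>p\<in>?T. g p *s H (exponent_word n p))"
    by (intro sum.cong) (auto simp: word_coeff_exponent_word)
  finally show ?thesis by (simp add: sum.cartesian_product split_beta)
qed

lemma power_in_generated_subalgebra: "v ^ m \<in> generated_subalgebra {v}"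
proof -
  have "v ^ m \<in> S" if "subalgebra S" "v \<in> S" for S
    using that by (induction m) (auto simp: subalgebra_def)
  then show ?thesis by (simp add: generated_subalgebra_def hull_def)
qed

lemma in_pc_image_power:
  assumes "explicit_eval x (v ^ m) v f = a"
  shows "a \<in> pc_image scale f v"
proof -
  have u: "v ^ m \<in> generated_subalgebra {v}" by (rule power_in_generated_subalgebra)
  have "a = pc_eval scale x (v ^ m) v f"
    using assms by (simp add: pc_eval_eq_explicit_eval[OF generated_subalgebra_commute[OF u]])
  with u show ?thesis unfolding pc_image_def by blast
qed

lemma type_one_image:
  assumes "core_attained v {1..n}" "type_one n r f" "f \<noteq> 0" "a \<in> commutator_core v"
  shows "a \<in> pc_image scale f v"
proof -
  interpret P: unital_algebra "pc_scale :: 'f \<Rightarrow> 'f pc_poly \<Rightarrow> 'f pc_poly"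
    by (rule unital_algebra_pc_scale)
  obtain coef where f: "f = (\<Sum>\<sigma> | \<sigma> permutes {1..n}. \<Sum>b\<in>weak_compositions n r.
      pc_scale (coef \<sigma> b) (word_b b (map \<sigma> [1..<n + 1])))"
    using assms(2) unfolding type_one_def by blast
  define c where "c = word_coeff n r (\<lambda>(\<sigma>, b). coef \<sigma> b)"
  have "\<exists>\<sigma> b. \<sigma> permutes {1..n} \<and> b \<in> weak_compositions n r \<and> coef \<sigma> b \<noteq> 0"
  proof (rule ccontr)
    assume "\<not> ?thesis"
    then have "f = 0" unfolding f by (intro sum.neutral ballI) auto
    with assms(3) show False by simp
  qed
  then have "\<exists>l\<in>dwords {1..n} r. c l \<noteq> 0"
    using exponent_word_in_dwords by (force simp: c_def word_coeff_exponent_word)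
  then obtain x where x: "word_sum v x {1..n} r c = a"
    using assms(1,4) unfolding core_attained_def by blast
  \<comment> \<open>The letter \<open>LU\<close> does not occur in \<open>f\<close>; the value
    \<open>v ^ 1\<close> for it is one choice inside F[v].\<close>
  have "explicit_eval x (v ^ 1) v f = word_sum v x {1..n} r c"
    by (simp add: f explicit_eval_sum explicit_eval_scale explicit_eval_word_b word_sum_def c_def
        sum_word_coeff del: upt_Suc One_nat_def)
  then show ?thesis unfolding x by (rule in_pc_image_power)
qed

text \<open>Expanding the commutators with \<open>u\<close> turns the value of \<open>f\<close> into
  an \<open>insert_sum\<close> whose coefficients are differences of neighbouring
  \<open>coef\<close>. As these start from 0 at the left end, they cannot all vanish.\<close>

lemma type_two_image:
  assumes "core_attained v {1..n}" "type_two n r f" "f \<noteq> 0" "a \<in> commutator_core v"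
  shows "a \<in> pc_image scale f v"
proof -
  interpret P: unital_algebra "pc_scale :: 'f \<Rightarrow> 'f pc_poly \<Rightarrow> 'f pc_poly"
    by (rule unital_algebra_pc_scale)
  obtain coef where f: "f = (\<Sum>\<sigma> | \<sigma> permutes {1..n}. \<Sum>b\<in>weak_compositions n r. \<Sum>i=1..n.
      pc_scale (coef \<sigma> i b) (word_bi b (\<sigma> i) (map \<sigma> [1..<n + 1])))"
    using assms(2) unfolding type_two_def by blast
  \<comment> \<open>Gap \<open>i\<close> receives \<open>u\<close> with a plus sign from the
    commutator at position \<open>Suc i\<close> and with a minus sign from the one at position
    \<open>i\<close>; the outer gaps have one neighbour only, hence the zeros.\<close>
  define d where "d i = (\<lambda>(\<sigma>, b).
    (if i < n then coef \<sigma> (Suc i) b else 0) - (if i = 0 then 0 else coef \<sigma> i b))" for i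
  define \<mu> where "\<mu> i = word_coeff n r (d i)" for i
  have "\<exists>\<sigma> b i. \<sigma> permutes {1..n} \<and> b \<in> weak_compositions n r \<and> i \<in> {1..n} \<and> coef \<sigma> i b \<noteq> 0"
  proof (rule ccontr)
    assume "\<not> ?thesis"
    then have "f = 0" unfolding f by (intro sum.neutral ballI) auto
    with assms(3) show False by simp
  qed
  then obtain \<sigma> b where \<sigma>: "\<sigma> permutes {1..n}" and b: "b \<in> weak_compositions n r"
    and ex: "\<exists>i. i < n \<and> coef \<sigma> (Suc i) b \<noteq> 0"
    by (metis Suc_le_eq Suc_pred' atLeastAtMost_iff less_eq_Suc_le One_nat_def)
  \<comment> \<open>At the first position with nonzero \<open>coef\<close> the left neighbour
    contributes 0, so the difference is nonzero.\<close>
  define i where "i = (LEAST i. i < n \<and> coef \<sigma> (Suc i) b \<noteq> 0)"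
  have i: "i < n" "coef \<sigma> (Suc i) b \<noteq> 0"
    using LeastI_ex[OF ex] by (simp_all add: i_def)
  have "i = 0 \<or> coef \<sigma> i b = 0"
    using not_less_Least[of "i - 1" "\<lambda>i. i < n \<and> coef \<sigma> (Suc i) b \<noteq> 0"] i(1)
    by (cases i) (auto simp: i_def)
  then have "\<mu> i (exponent_word n (\<sigma>, b)) \<noteq> 0"
    using i by (auto simp: \<mu>_def word_coeff_exponent_word[OF \<sigma> b] d_def)
  then have "\<exists>l\<in>dwords {1..n} r. \<exists>i\<le>card {1..n}. \<mu> i l \<noteq> 0"
    using exponent_word_in_dwords[OF \<sigma> b] i(1) by (metis card_atLeastAtMost diff_Suc_1 less_imp_le)
  then obtain x m where x: "insert_sum v x (v ^ m) {1..n} r \<mu> = a"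
    using core_attained_insert_sum[OF assms(1) _ assms(4)] by blast
  define u where "u = v ^ m"
  have uv: "u * v = v * u" by (simp add: u_def power_commutes)
  define R where "R k l = dword_val v x (take k l) * u * dword_val v x (drop k l)" for k l
  \<comment> \<open>Summation by parts: the sum over positions is regrouped by gaps.\<close>
  have telescope: "(\<Sum>i=1..n. coef \<sigma> i b *s explicit_eval x u v (word_bi b (\<sigma> i) (map \<sigma> [1..<n + 1]))) =
      (\<Sum>i\<le>n. d i (\<sigma>, b) *s R i (exponent_word n (\<sigma>, b)))" (is "?L = ?R")
    if "\<sigma> permutes {1..n}" for \<sigma> b
  proof -
    let ?l = "exponent_word n (\<sigma>, b)"
    have "?L = (\<Sum>i<n. coef \<sigma> (Suc i) b *s
        explicit_eval x u v (word_bi b (\<sigma> (Suc i)) (map \<sigma> [1..<n + 1])))"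
      unfolding One_nat_def by (rule sum.atLeast1_atMost_eq)
    also have "\<dots> = (\<Sum>i<n. coef \<sigma> (Suc i) b *s (R i ?l - R (Suc i) ?l))"
      unfolding R_def by (intro sum.cong refl) (simp only: explicit_eval_word_bi[OF uv that] lessThan_iff)
    also have "\<dots> = (\<Sum>i<n. coef \<sigma> (Suc i) b *s R i ?l) - (\<Sum>i<n. coef \<sigma> (Suc i) b *s R (Suc i) ?l)"
      by (simp add: scale_right_diff_distrib sum_subtractf)
    also have "(\<Sum>i<n. coef \<sigma> (Suc i) b *s R i ?l) =
        (\<Sum>i\<le>n. (if i < n then coef \<sigma> (Suc i) b else 0) *s R i ?l)"
      by (simp flip: lessThan_Suc_atMost)
    also have "(\<Sum>i<n. coef \<sigma> (Suc i) b *s R (Suc i) ?l) =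
        (\<Sum>i\<le>n. (if i = 0 then 0 else coef \<sigma> i b) *s R i ?l)"
      unfolding lessThan_Suc_atMost[symmetric] sum.lessThan_Suc_shift by simp
    finally show ?thesis by (simp add: d_def scale_left_diff_distrib sum_subtractf)
  qed
  have "explicit_eval x u v f = (\<Sum>\<sigma> | \<sigma> permutes {1..n}. \<Sum>b\<in>weak_compositions n r. \<Sum>i\<le>n.
      d i (\<sigma>, b) *s R i (exponent_word n (\<sigma>, b)))"
    unfolding f explicit_eval_sum explicit_eval_scale by (intro sum.cong refl telescope) simp
  also have "\<dots> = (\<Sum>i\<le>n. \<Sum>\<sigma> | \<sigma> permutes {1..n}. \<Sum>b\<in>weak_compositions n r.
      d i (\<sigma>, b) *s R i (exponent_word n (\<sigma>, b)))"
    by (simp add: sum.swap[of _ _ "{..n}"])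
  also have "\<dots> = insert_sum v x u {1..n} r \<mu>"
    by (simp add: insert_sum_def \<mu>_def sum_word_coeff R_def del: One_nat_def)
  finally have "explicit_eval x (v ^ m) v f = a" unfolding u_def x .
  then show ?thesis by (rule in_pc_image_power)
qed

end

theorem theorem4p7:
  fixes scale :: "'f::field \<Rightarrow> 'a::{ring,monoid_mult} \<Rightarrow> 'a"
    and v :: 'a
    and n :: nat
    and f :: "'f pc_poly"
  assumes "unital_algebra scale"
    and "1 \<in> commutator_core v"
    and "n \<ge> 1"
    and "f \<in> pc_polys n"
    and "f \<noteq> 0"
    and "admissible n f"
  shows "commutator_core v \<subseteq> pc_image scale f v"
proof -
  interpret unital_algebra scale by (rule assms(1))
  have "core_attained v {1..n}" using core_attained[OF assms(2)] assms(3) by simp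
  then show ?thesis
    using assms(5,6) type_one_image type_two_image unfolding admissible_def by blast
qed

end
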